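(* Let $u:\mathbb{R}^2\to\mathbb{R}$ be defined by $u(x,y)=3$ when $x=0$ and $u(x,y)=1$ when $x\neq 0$, and let $v:\mathbb{R}^2\to\mathbb{R}$ be the (harmonic) constant function $v(x,y)\equiv -2$. Then $u$ is $3$-quasinearly subharmonic in $\mathbb{R}^2$ and $v$ is quasinearly subharmonic in $\mathbb{R}^2$, but the sum $u+v$ is not quasinearly subharmonic in $\mathbb{R}^2$. In particular, the sum of two quasinearly subharmonic functions can fail to be quasinearly subharmonic.
   Context: $B^N(x,r)$ is the open ball in $\mathbb{R}^N$ with center $x$ and radius $r>0$, $\overline{B^N(x,r)}$ its closure, $m_N$ is Lebesgue measure on $\mathbb{R}^N$, $\nu_N$ is the volume of the unit ball of $\mathbb{R}^N$, and $u^+=\max\{u,0\}$. Let $D$ be a domain in $\mathbb{R}^N$, $N\geq 2$. For $u: D\to[-\infty,+\infty)$ and $M\geq 0$ write $u_M:=\max\{u,-M\}+M$. For $K\in[1,+\infty)$, a Lebesgue measurable function $u: D\to[-\infty,+\infty)$ is $K$-quasinearly subharmonic if $u^+\in\mathcal{L}^1_{\mathrm{loc}}(D)$ and $$u_M(x)\leq \frac{K}{\nu_N r^N}\int_{B^N(x,r)}u_M(y)\,dm_N(y)$$ for all $M\geq 0$ and all closed balls $\overline{B^N(x,r)}\subset D$. A function is quasinearly subharmonic if it is $K$-quasinearly subharmonic for some $K\in[1,+\infty)$. *)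

theory Defs
  imports "HOL-Analysis.Analysis"
begin

text \<open>
  A function \<open>D \<rightarrow> [-\<infinity>,+\<infinity>)\<close> is represented by a total function into \<^typ>\<open>ereal\<close>; its values
  outside \<open>D\<close> play no role.
\<close>

definition domain :: "'a::euclidean_space set \<Rightarrow> bool" where
  "domain D \<longleftrightarrow> open D \<and> connected D \<and> D \<noteq> {}"

definition locally_L1 :: "'a::euclidean_space set \<Rightarrow> ('a \<Rightarrow> ereal) \<Rightarrow> bool" where
  "locally_L1 D f \<longleftrightarrow>
     f \<in> borel_measurable (lebesgue_on D) \<and>
     (\<forall>C. compact C \<and> C \<subseteq> D \<longrightarrow> (\<integral>\<^sup>+ y\<in>C. e2ennreal \<bar>f y\<bar> \<partial>lebesgue) < \<infinity>)"

definition shifted_cut :: "real \<Rightarrow> ('a \<Rightarrow> ereal) \<Rightarrow> 'a \<Rightarrow> ereal" where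
  "shifted_cut M u x = max (u x) (- ereal M) + ereal M"

text \<open>
  Below, \<^const>\<open>shifted_cut\<close> \<open>M u\<close> is nonnegative, so passing to \<^typ>\<open>ennreal\<close> under the integral
  loses nothing.
\<close>

definition K_quasinearly_subharmonic ::
    "real \<Rightarrow> 'a::euclidean_space set \<Rightarrow> ('a \<Rightarrow> ereal) \<Rightarrow> bool" where
  "K_quasinearly_subharmonic K D u \<longleftrightarrow>
     1 \<le> K \<and>
     (\<forall>x\<in>D. u x < \<infinity>) \<and>
     u \<in> borel_measurable (lebesgue_on D) \<and>
     locally_L1 D (\<lambda>x. max (u x) 0) \<and>
     (\<forall>M\<ge>0. \<forall>x. \<forall>r>0. cball x r \<subseteq> D \<longrightarrow>
        shifted_cut M u x
          \<le> ereal (K / (measure lebesgue (ball (0::'a) 1) * r ^ DIM('a))) *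
            enn2ereal (\<integral>\<^sup>+ y\<in>ball x r. e2ennreal (shifted_cut M u y) \<partial>lebesgue))"

definition quasinearly_subharmonic ::
    "'a::euclidean_space set \<Rightarrow> ('a \<Rightarrow> ereal) \<Rightarrow> bool" where
  "quasinearly_subharmonic D u \<longleftrightarrow> (\<exists>K. K_quasinearly_subharmonic K D u)"

text \<open>
  Twice continuously differentiable with vanishing Laplacian: \<open>g\<close> is the gradient and \<open>H\<close> the
  Hessian, whose trace is the Laplacian.
\<close>

definition harmonic_on :: "'a::euclidean_space set \<Rightarrow> ('a \<Rightarrow> real) \<Rightarrow> bool" where
  "harmonic_on D h \<longleftrightarrow>
     (\<exists>(g :: 'a \<Rightarrow> 'a) (H :: 'a \<Rightarrow> 'a \<Rightarrow>\<^sub>L 'a).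
        (\<forall>x\<in>D. GDERIV h x :> g x) \<and>
        (\<forall>x\<in>D. (g has_derivative blinfun_apply (H x)) (at x)) \<and>
        continuous_on D H \<and>
        (\<forall>x\<in>D. (\<Sum>b\<in>Basis. blinfun_apply (H x) b \<bullet> b) = 0))"

end

(* A measurable f that equals a constant c almost everywhere has the mean value
   max c (-M) + M for its cut f_M over every ball, so quasinearly subharmonicity is a
   pointwise inequality. For u it reads M + 3 \<le> 3 (M + 1). Adding -2 moves the generic
   value to -1, whose cut at M = 0 vanishes, while the value on the line x = 0 is 1. *)
theory Submission
  imports Defs
begin

lemma shifted_cut_ereal:
  "shifted_cut M (\<lambda>x. ereal (f x)) x = ereal (max (f x) (- M) + M)"
  by (simp add: shifted_cut_def max_def)

lemma set_nn_integral_AE_const: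
  fixes g :: "'a \<Rightarrow> ennreal"
  assumes "AE x in N. g x = c" and "A \<in> sets N"
  shows "(\<integral>\<^sup>+ x\<in>A. g x \<partial>N) = c * emeasure N A"
proof -
  have "(\<integral>\<^sup>+ x\<in>A. g x \<partial>N) = (\<integral>\<^sup>+ x\<in>A. c \<partial>N)"
    using assms(1) by (intro nn_integral_cong_AE) auto
  then show ?thesis
    using assms(2) by (simp add: nn_integral_cmult_indicator)
qed

text \<open>Compact sets have finite Lebesgue measure, so each integral is \<bar>c\<bar> times a
  finite number. This settles the integrability clause of quasinearly subharmonicity.\<close>

lemma locally_L1_AE_const:
  fixes f :: "'a::euclidean_space \<Rightarrow> real"
  assumes "f \<in> borel_measurable lebesgue" and "AE x in lebesgue. f x = c"
  shows "locally_L1 UNIV (\<lambda>x. ereal (f x))"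
  unfolding locally_L1_def
proof (intro conjI allI impI)
  show "(\<lambda>x. ereal (f x)) \<in> borel_measurable (lebesgue_on UNIV)"
    using assms(1) by (simp add: lebesgue_on_UNIV_eq)
  fix C :: "'a set" assume C: "compact C \<and> C \<subseteq> UNIV"
  then have m: "C \<in> sets lebesgue" and fin: "emeasure lebesgue C < \<infinity>"
    using lmeasurable_compact[of C] by (auto simp: fmeasurable_def)
  have "AE x in lebesgue. e2ennreal \<bar>ereal (f x)\<bar> = ennreal \<bar>c\<bar>"
    using assms(2) by eventually_elim simp
  from set_nn_integral_AE_const[OF this m]
  show "(\<integral>\<^sup>+ y\<in>C. e2ennreal \<bar>ereal (f y)\<bar> \<partial>lebesgue) < \<infinity>"
    using fin by (simp add: ennreal_mult_less_top)
qed

text \<open>The integral of the cut over a ball is its a.e. value times the volume of the ball, and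
  the normalising factor cancels that volume. Center and radius thus drop out of the right-hand
  side.\<close>

lemma K_quasinearly_subharmonic_AE_const_iff:
  fixes f :: "'a::euclidean_space \<Rightarrow> real"
  assumes f: "f \<in> borel_measurable lebesgue" and c: "AE x in lebesgue. f x = c"
  shows "K_quasinearly_subharmonic K UNIV (\<lambda>x. ereal (f x)) \<longleftrightarrow>
    1 \<le> K \<and> (\<forall>M\<ge>0. \<forall>x. max (f x) (- M) + M \<le> K * (max c (- M) + M))"
proof -
  have mean: "ereal (K / (measure lebesgue (ball (0::'a) 1) * r ^ DIM('a))) *
      enn2ereal (\<integral>\<^sup>+ y\<in>ball x r. e2ennreal (shifted_cut M (\<lambda>x. ereal (f x)) y) \<partial>lebesgue)
      = ereal (K * (max c (- M) + M))" if "r > 0" for x :: 'a and r M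
  proof -
    let ?m = "max c (- M) + M"
    have "AE y in lebesgue. e2ennreal (shifted_cut M (\<lambda>x. ereal (f x)) y) = ennreal ?m"
      using c by eventually_elim (simp add: shifted_cut_ereal)
    then have "(\<integral>\<^sup>+ y\<in>ball x r. e2ennreal (shifted_cut M (\<lambda>x. ereal (f x)) y) \<partial>lebesgue)
        = ennreal ?m * emeasure lebesgue (ball x r)"
      by (rule set_nn_integral_AE_const) simp
    \<comment> \<open>\<open>?m\<close> is nonnegative for every real \<open>M\<close>, because
      \<open>max c (- M)\<close> is at least \<open>- M\<close>; hence \<open>ennreal\<close>
      truncates nothing.\<close>
    also have "\<dots> = ennreal (?m * (unit_ball_vol (real DIM('a)) * r ^ DIM('a)))"
      using that by (simp add: emeasure_ball ennreal_mult')
    finally have "enn2ereal (\<integral>\<^sup>+ y\<in>ball x r. e2ennreal (shifted_cut M (\<lambda>x. ereal (f x)) y) \<partial>lebesgue)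
        = ereal (?m * (unit_ball_vol (real DIM('a)) * r ^ DIM('a)))"
      using that by (simp add: enn2ereal_ennreal)
    moreover have "measure lebesgue (ball (0::'a) 1) = unit_ball_vol (real DIM('a))"
      by (simp add: content_ball)
    \<comment> \<open>Needed for the cancellation: with volume 0 the quotient would be 0 by the
      convention on division.\<close>
    moreover have "unit_ball_vol (real DIM('a)) \<noteq> 0"
      using unit_ball_vol_pos[of "real DIM('a)"] by linarith
    ultimately show ?thesis
      using that by simp
  qed
  have pointwise: "shifted_cut M (\<lambda>x. ereal (f x)) x
      \<le> ereal (K / (measure lebesgue (ball (0::'a) 1) * r ^ DIM('a))) *
        enn2ereal (\<integral>\<^sup>+ y\<in>ball x r. e2ennreal (shifted_cut M (\<lambda>x. ereal (f x)) y) \<partial>lebesgue)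
      \<longleftrightarrow> max (f x) (- M) + M \<le> K * (max c (- M) + M)" if "r > 0" for x :: 'a and r M
    by (subst mean[OF that]) (simp add: shifted_cut_ereal)
  \<comment> \<open>The positive part is again constant a.e., so \<open>locally_L1_AE_const\<close>
    applies to it.\<close>
  have "AE x in lebesgue. max (f x) 0 = max c 0"
    using c by eventually_elim simp
  then have "locally_L1 UNIV (\<lambda>x. ereal (max (f x) 0))"
    using f by (intro locally_L1_AE_const) auto
  moreover have "(\<lambda>x. ereal (max (f x) 0)) = (\<lambda>x. max (ereal (f x)) 0)"
    by (auto simp: max_def)
  ultimately have "locally_L1 UNIV (\<lambda>x. max (ereal (f x)) 0)"
    by simp
  moreover have "(\<lambda>x. ereal (f x)) \<in> borel_measurable (lebesgue_on UNIV)"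
    using f by (simp add: lebesgue_on_UNIV_eq)
  ultimately have "K_quasinearly_subharmonic K UNIV (\<lambda>x. ereal (f x)) \<longleftrightarrow>
      1 \<le> K \<and> (\<forall>M\<ge>0. \<forall>x. \<forall>r>0::real. max (f x) (- M) + M \<le> K * (max c (- M) + M))"
    unfolding K_quasinearly_subharmonic_def
    by (simp add: pointwise del: measure_completion cong: imp_cong)
  \<comment> \<open>The inequality no longer mentions \<open>r\<close>; one positive radius suffices
    to remove the quantifier.\<close>
  moreover have "\<exists>r::real. r > 0"
    by (rule exI[of _ 1]) simp
  ultimately show ?thesis
    by blast
qed

lemma harmonic_on_const: "harmonic_on D (\<lambda>x. c)"
  unfolding harmonic_on_def
  by (rule exI[of _ "\<lambda>x. 0"], rule exI[of _ "\<lambda>x. 0"])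
     (auto simp: GDERIV_const zero_blinfun.rep_eq)

theorem mainTheorem3:
  fixes u v :: "real^2 \<Rightarrow> real"
  assumes u: "\<And>p. u p = (if p $ 1 = 0 then 3 else 1)"
    and v: "\<And>p. v p = -2"
  shows "K_quasinearly_subharmonic 3 UNIV (\<lambda>p. ereal (u p))
    \<and> harmonic_on UNIV v
    \<and> quasinearly_subharmonic UNIV (\<lambda>p. ereal (v p))
    \<and> \<not> quasinearly_subharmonic UNIV (\<lambda>p. ereal (u p + v p))
    \<and> (\<exists>(D :: (real^2) set) (f :: real^2 \<Rightarrow> ereal) (g :: real^2 \<Rightarrow> ereal).
          domain D \<and> quasinearly_subharmonic D f \<and> quasinearly_subharmonic D g
          \<and> \<not> quasinearly_subharmonic D (\<lambda>p. f p + g p))"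
proof -
  \<comment> \<open>That the line is null serves twice: it makes the line measurable, hence
    \<open>u\<close> measurable, and it gives \<open>u = 1\<close> a.e.\<close>
  have "negligible {p :: real^2. p $ 1 = 0}"
    by (rule negligible_standard_hyperplane_cart)
  then have null: "{p :: real^2. p $ 1 = 0} \<in> null_sets lebesgue"
    by (simp add: negligible_iff_null_sets)
  have u_meas: "u \<in> borel_measurable lebesgue"
  proof -
    have "u = (\<lambda>p. if p \<in> {p. p $ 1 = 0} then 3 else 1)"
      using u by auto
    also have "\<dots> \<in> borel_measurable lebesgue"
      using null by (intro measurable_If_set) (auto simp: null_sets_def)
    finally show ?thesis .
  qed
  have u_AE: "AE p in lebesgue. u p = 1"
    using AE_not_in[OF null] by eventually_elim (simp add: u)
  \<comment> \<open>At \<open>M = 0\<close> the inequality on the line is an equality, so 3 is the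
    least possible constant.\<close>
  have qu: "K_quasinearly_subharmonic 3 UNIV (\<lambda>p. ereal (u p))"
    by (subst K_quasinearly_subharmonic_AE_const_iff[OF u_meas u_AE]) (auto simp: u)
  have v_eq: "v = (\<lambda>p. -2)"
    using v by auto
  have "K_quasinearly_subharmonic 1 UNIV (\<lambda>p. ereal (v p))"
    by (subst K_quasinearly_subharmonic_AE_const_iff[where c = "-2"]) (auto simp: v_eq)
  then have qv: "quasinearly_subharmonic UNIV (\<lambda>p. ereal (v p))"
    unfolding quasinearly_subharmonic_def by blast
  have "\<not> K_quasinearly_subharmonic K UNIV (\<lambda>p. ereal (u p + v p))" for K
  proof -
    have "(\<lambda>p. u p + v p) \<in> borel_measurable lebesgue"
      using u_meas by (simp add: v_eq)
    moreover have "AE p in lebesgue. u p + v p = -1"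
      using u_AE by eventually_elim (simp add: v)
    \<comment> \<open>The origin lies on the exceptional line. At \<open>M = 0\<close> the claim
      would read 1 \<le> K * 0, which no \<open>K\<close> satisfies.\<close>
    moreover have "\<not> max (u 0 + v 0) (- 0) + 0 \<le> K * (max (-1) (- 0) + 0)"
      by (simp add: u v)
    ultimately show ?thesis
      by (subst K_quasinearly_subharmonic_AE_const_iff[where c = "-1"]) blast+
  qed
  then have not_sum: "\<not> quasinearly_subharmonic UNIV (\<lambda>p. ereal (u p + v p))"
    unfolding quasinearly_subharmonic_def by blast
  have "domain (UNIV :: (real^2) set)"
    by (simp add: domain_def convex_connected)
  moreover have "quasinearly_subharmonic UNIV (\<lambda>p. ereal (u p))"
    using qu unfolding quasinearly_subharmonic_def by blast
  moreover have "\<not> quasinearly_subharmonic UNIV (\<lambda>p. ereal (u p) + ereal (v p))"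
    using not_sum by simp
  ultimately show ?thesis
    using qu qv not_sum harmonic_on_const[of UNIV "-2"] unfolding v_eq by blast
qed

end
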